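(* Let $a\in\mathbb R$ and let $s:[a,\infty)\to\mathbb C$ satisfy: $s\in L^1_{\mathrm{loc}}[a,\infty)$; $s(x)\ne0$ and $\arg s(x)\neq\pi$ for all $x\in[a,\infty)$; and, with $u:=s^{-1/4}$, $u,u'\in \mathrm{AC}_{\mathrm{loc}}(a,\infty)$ and $u\,u''\in L^1(a,\infty)$. Let $\{y,\widehat y\}$ be a fundamental system of $y''(x)=s(x)y(x)$, $x\in[a,\infty)$, of the form $$y(x)=s(x)^{-1/4}e^{-\int_a^x s(t)^{1/2}\,dt}(1+F_1(x)),\qquad \widehat y(x)=s(x)^{-1/4}e^{\int_a^x s(t)^{1/2}\,dt}(1+\widehat F_1(x)),$$ where $F_1,\widehat F_1:[a,\infty)\to\mathbb C$ are bounded and $F_1(x),\widehat F_1(x)\to0$ as $x\to\infty$. Then $\widehat y\notin L^2[a,\infty)$ if one (or more) of the following conditions is satisfied: (a) $|s|^{-1/2}\notin L^1[a,\infty)$. (b) The function $s$ is bounded, i.e. $s\in L^\infty$. (c) $\displaystyle\int_a^\infty\operatorname{Re}[s(x)^{1/2}]\,dx<\infty$ and $\displaystyle\liminf_{x\to\infty}\frac{\operatorname{Re}[s(x)^{1/2}]}{|s(x)|^{1/2}}>0$. (d) $\displaystyle\int_a^\infty\operatorname{Re}[s(x)^{1/2}]\,dx=\infty$ and $\displaystyle\liminf_{x\to\infty}\frac{\left(\operatorname{Re}[s(x)^{1/2}]\right)^N}{|s(x)^{1/2}|}>0$ for some $N\in\mathbb N$. (e) $|\arg s|\le\pi-\epsilon_0$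 on $[a,\infty)$ for some $\epsilon_0>0$.
   Context: Roots are principal: $z^{1/n}=r^{1/n}e^{i\arg(z)/n}$ for $z=re^{i\arg z}$, $-\pi<\arg z\le\pi$. $\mathrm{AC}_{\mathrm{loc}}(a,\infty)$ denotes functions absolutely continuous on each compact subinterval of $(a,\infty)$. A solution of $y''=sy$ is a function $y$ with $y,y'\in \mathrm{AC}_{\mathrm{loc}}(a,\infty)$ satisfying the equation for almost all $x\in[a,\infty)$, the endpoint $a$ being regular. Under the stated assumptions on $s$, a fundamental system of the described form is known to exist (with $\|F_1\|_\infty,\|\widehat F_1\|_\infty\le 2e^{2M}-2$, $M=\|uu''\|_{L^1}$). *)

theory Defs
  imports "HOL-Analysis.Analysis"
begin

text \<open>
  The epsilon-delta definition of absolute continuity on a real interval. A division of \<open>T\<close> is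
  a finite set of compact intervals \<open>k = {Inf k..Sup k}\<close> with pairwise disjoint interiors and
  union \<open>T\<close>; as \<open>T \<subseteq> S\<close> is arbitrary, \<open>\<D>\<close> ranges over all finite families of non-overlapping
  compact subintervals of \<open>S\<close>.
\<close>

definition abs_continuous_on :: "real set \<Rightarrow> (real \<Rightarrow> complex) \<Rightarrow> bool" where
  "abs_continuous_on S f \<longleftrightarrow>
     (\<forall>\<epsilon>>0. \<exists>\<delta>>0. \<forall>\<D> T. \<D> division_of T \<and> T \<subseteq> S \<and> (\<Sum>k\<in>\<D>. Sup k - Inf k) < \<delta> \<longrightarrow>
        (\<Sum>k\<in>\<D>. norm (f (Sup k) - f (Inf k))) < \<epsilon>)"

definition AC_loc :: "real \<Rightarrow> (real \<Rightarrow> complex) \<Rightarrow> bool" where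
  "AC_loc a f \<longleftrightarrow> (\<forall>c d. a < c \<and> c \<le> d \<longrightarrow> abs_continuous_on {c..d} f)"

text \<open>
  \<open>f\<close> and its derivative \<open>f'\<close> belong to \<open>AC_loc(a,\<infinity>)\<close>, and \<open>f''\<close> is the second derivative of \<open>f\<close>.
  An absolutely continuous \<open>f\<close> whose almost everywhere derivative has a continuous
  representative \<open>f'\<close> is differentiable at every point with derivative \<open>f'\<close>; the absolutely
  continuous \<open>f'\<close> is differentiable only almost everywhere, so \<open>f''\<close> is determined only
  up to a null set.
\<close>

definition AC_loc_derivs ::
    "real \<Rightarrow> (real \<Rightarrow> complex) \<Rightarrow> (real \<Rightarrow> complex) \<Rightarrow> (real \<Rightarrow> complex) \<Rightarrow> bool" where
  "AC_loc_derivs a f f' f'' \<longleftrightarrow>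
     AC_loc a f \<and> AC_loc a f' \<and>
     (\<forall>x>a. (f has_vector_derivative f' x) (at x)) \<and>
     (AE x in lebesgue. a < x \<longrightarrow> (f' has_vector_derivative f'' x) (at x))"

definition L1_loc :: "real \<Rightarrow> (real \<Rightarrow> complex) \<Rightarrow> bool" where
  "L1_loc a f \<longleftrightarrow> (\<forall>b\<ge>a. f absolutely_integrable_on {a..b})"

definition L2_on :: "real set \<Rightarrow> (real \<Rightarrow> complex) \<Rightarrow> bool" where
  "L2_on S f \<longleftrightarrow>
     set_borel_measurable lebesgue S f \<and> (\<lambda>x. (norm (f x))\<^sup>2) absolutely_integrable_on S"

definition Linf_on :: "real set \<Rightarrow> (real \<Rightarrow> complex) \<Rightarrow> bool" where
  "Linf_on S f \<longleftrightarrow>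
     set_borel_measurable lebesgue S f \<and> (\<exists>C. AE x in lebesgue. x \<in> S \<longrightarrow> norm (f x) \<le> C)"

definition is_solution :: "real \<Rightarrow> (real \<Rightarrow> complex) \<Rightarrow> (real \<Rightarrow> complex) \<Rightarrow> bool" where
  "is_solution a s y \<longleftrightarrow>
     (\<exists>y' y''. AC_loc_derivs a y y' y'' \<and> (AE x in lebesgue. a \<le> x \<longrightarrow> y'' x = s x * y x))"

text \<open>
  Linear independence is taken over \<open>(a,\<infinity>)\<close>: a solution is constrained only there, its value at
  the single point \<open>a\<close> being immaterial.
\<close>

definition fundamental_system ::
    "real \<Rightarrow> (real \<Rightarrow> complex) \<Rightarrow> (real \<Rightarrow> complex) \<Rightarrow> (real \<Rightarrow> complex) \<Rightarrow> bool" where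
  "fundamental_system a s y z \<longleftrightarrow>
     is_solution a s y \<and> is_solution a s z \<and>
     (\<forall>c d. (\<forall>x>a. c * y x + d * z x = 0) \<longrightarrow> c = 0 \<and> d = 0)"

end

theory Submission
  imports Defs
begin

text \<open>
  Put \<open>r = |s|\<^sup>1\<^sup>/\<^sup>2 = |u|\<^sup>-\<^sup>2\<close>, \<open>q = Re s\<^sup>1\<^sup>/\<^sup>2\<close> and \<open>Q(x) = \<integral>\<^sub>a\<^sup>x q \<ge> 0\<close>, so that \<open>|yh|\<^sup>2\<close> is eventually at
  least \<open>e\<^sup>2\<^sup>Q / (4 r)\<close>.

  In each of the cases (b)--(e) there are \<open>N\<close> and \<open>\<delta> > 0\<close> with \<open>q\<^sup>N \<ge> \<delta> r\<close> eventually.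
  With \<open>k = 2 / (N + 1)\<close> and \<open>t = q e\<^sup>-\<^sup>k\<^sup>Q\<close>, Bernoulli's
  inequality gives \<open>e\<^sup>2\<^sup>Q / r \<ge> \<delta> e\<^sup>2\<^sup>Q q\<^sup>-\<^sup>N \<ge> \<delta> t\<^sup>-\<^sup>N \<ge> \<delta> (N + 1 - N t)\<close>, and \<open>t\<close> has integral at most \<open>1 / k\<close>,
  so the left-hand side is not integrable.

  In case (a) it suffices that \<open>|s|\<^sup>-\<^sup>1\<^sup>/\<^sup>2 = |u|\<^sup>2\<close> is integrable near \<open>a\<close>. As \<open>|arg u| < \<pi>/4\<close>, boundedness
  of \<open>u\<close> near \<open>a\<close> follows from that of \<open>v = Re u\<close>; and where \<open>v \<ge> 1\<close> the integrable function \<open>|u u''|\<close>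
  dominates \<open>|v''|\<close>, so \<open>v'\<close> has bounded variation there.
\<close>

section \<open>Fundamental theorem of calculus for absolutely continuous functions\<close>

text \<open>The straddle estimate: the linearisation errors at the tag \<open>x\<close> are
  subtracted, and because \<open>x\<close> lies between \<open>u\<close> and \<open>v\<close> the
  two distances add up to \<open>v - u\<close>.\<close>

lemma increment_approx_le:
  fixes f :: "real \<Rightarrow> 'a::real_normed_vector"
  assumes "u \<le> x" "x \<le> v"
    and u: "norm (f u - f x - (u - x) *\<^sub>R g) \<le> e * \<bar>u - x\<bar>"
    and v: "norm (f v - f x - (v - x) *\<^sub>R g) \<le> e * \<bar>v - x\<bar>"
  shows "norm ((v - u) *\<^sub>R g - (f v - f u)) \<le> e * (v - u)"
proof -
  have "(v - u) *\<^sub>R g - (f v - f u)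
      = (f u - f x - (u - x) *\<^sub>R g) - (f v - f x - (v - x) *\<^sub>R g)"
    by (simp add: algebra_simps)
  also have "norm \<dots> \<le> e * \<bar>u - x\<bar> + e * \<bar>v - x\<bar>"
    using norm_triangle_ineq4 u v by (rule order_trans[OF _ add_mono])
  also have "\<dots> = e * (v - u)"
    using assms by (simp add: algebra_simps)
  finally show ?thesis .
qed

text \<open>The sum of lengths is the integral of 1 over \<open>T\<close>. This turns smallness of
  an open set in measure into the length condition of absolute continuity.\<close>

lemma sum_content_division_le_measure:
  fixes \<D> :: "real set set"
  assumes "\<D> division_of T" "T \<subseteq> U" "U \<in> lmeasurable"
  shows "(\<Sum>K\<in>\<D>. Sup K - Inf K) \<le> measure lebesgue U"
proof (rule has_integral_subset_le)
  show "T \<subseteq> U" by fact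
  show "((\<lambda>_. 1) has_integral measure lebesgue U) U"
    using assms(3) by (simp add: has_integral_iff lmeasurable_iff_integrable_on lmeasure_integral)
  show "((\<lambda>_. 1::real) has_integral (\<Sum>K\<in>\<D>. Sup K - Inf K)) T"
  proof (rule has_integral_combine_division[OF assms(1)])
    fix K assume "K \<in> \<D>"
    then obtain u v where "K = {u..v}" "u \<le> v"
      using assms(1) by (metis atLeastatMost_empty_iff2 cbox_division_memE cbox_interval not_le)
    then show "((\<lambda>_. 1::real) has_integral Sup K - Inf K) K"
      using has_integral_const_real[of "1::real" u v] by simp
  qed
qed auto

text \<open>
  The intervals of a fine tagged division whose tag lies in \<open>N\<close> are forced into an open superset
  of \<open>N\<close> of small measure, where absolute continuity bounds the increments of \<open>f\<close>.
\<close>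
lemma has_integral_abs_continuous_derivative:
  assumes "c \<le> d" and ac: "abs_continuous_on {c..d} f" and N: "negligible N"
    and der: "\<And>x. x \<in> {c..d} - N \<Longrightarrow> (f has_vector_derivative g x) (at x within {c..d})"
  shows "(g has_integral (f d - f c)) {c..d}"
proof (cases "c = d")
  case False
  \<comment> \<open>The values of \<open>g\<close> on \<open>N\<close> are arbitrary; replacing them
    by 0 makes tags in \<open>N\<close> contribute only increments of \<open>f\<close>.\<close>
  define g' where "g' x = (if x \<in> N then 0 else g x)" for x
  have "(g' has_integral (f d - f c)) {c..d}"
    unfolding has_integral_factor_content_real
  proof (intro allI impI)
    fix e :: real assume "e > 0"
    \<comment> \<open>Half of the admissible error \<open>e * (d - c)\<close>: one half is for tags
      outside \<open>N\<close>, the other for tags in \<open>N\<close>.\<close>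
    define e' where "e' = e * (d - c) / 2"
    have "e' > 0" using \<open>e > 0\<close> \<open>c \<le> d\<close> False by (simp add: e'_def)
    then have "\<exists>\<delta>>0. \<forall>\<D> T. \<D> division_of T \<and> T \<subseteq> {c..d} \<and> (\<Sum>k\<in>\<D>. Sup k - Inf k) < \<delta> \<longrightarrow>
        (\<Sum>k\<in>\<D>. norm (f (Sup k) - f (Inf k))) < e'"
      using ac[unfolded abs_continuous_on_def, rule_format] by simp
    then obtain \<delta> where "\<delta> > 0" and \<delta>: "\<forall>\<D> T. \<D> division_of T \<and> T \<subseteq> {c..d} \<and>
        (\<Sum>k\<in>\<D>. Sup k - Inf k) < \<delta> \<longrightarrow> (\<Sum>k\<in>\<D>. norm (f (Sup k) - f (Inf k))) < e'"
      by (elim exE conjE)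
    obtain U where U: "open U" "N \<subseteq> U" "U - N \<in> lmeasurable" "emeasure lebesgue (U - N) < ennreal \<delta>"
      using sets_lebesgue_outer_open[of N \<delta>] N \<open>\<delta> > 0\<close>
      by (metis fmeasurableD negligible_imp_measurable)
    have UN: "U = (U - N) \<union> N" using U by auto
    have Um: "U \<in> lmeasurable"
      by (subst UN) (intro fmeasurable.Un U(3) negligible_imp_measurable N)
    have "measure lebesgue U \<le> measure lebesgue (U - N) + measure lebesgue N"
      by (subst UN) (intro measure_Un_le fmeasurableD U(3) negligible_imp_measurable N)
    also have "\<dots> < \<delta>"
      using U(3,4) \<open>\<delta> > 0\<close> negligible_imp_measure0[OF N]
      by (simp add: emeasure_eq_measure2 ennreal_less_iff)
    finally have U\<delta>: "measure lebesgue U < \<delta>" .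
    \<comment> \<open>The gauge radius depends on the tag: in \<open>N\<close> it keeps the interval
      inside \<open>U\<close>, elsewhere it makes the linear approximation accurate to slope error
      \<open>e/2\<close>.\<close>
    have "\<exists>r>0. (x \<in> N \<longrightarrow> ball x r \<subseteq> U) \<and> (x \<in> {c..d} - N \<longrightarrow>
         (\<forall>y\<in>{c..d}. norm (y-x) < r \<longrightarrow> norm (f y - f x - (y-x) *\<^sub>R g x) \<le> e/2 * norm (y-x)))" for x
    proof (cases "x \<in> N")
      case True
      then show ?thesis using U by (meson DiffD2 openE subset_iff)
    next
      case False
      have "\<exists>r>0. \<forall>y\<in>{c..d}. norm (y-x) < r \<longrightarrow>
          norm (f y - f x - (y-x) *\<^sub>R g x) \<le> e/2 * norm (y-x)" if "x \<in> {c..d}"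
      proof -
        have "e / 2 > 0" using \<open>e > 0\<close> by simp
        with der[of x] that False show ?thesis
          unfolding has_vector_derivative_def has_derivative_within_alt by blast
      qed
      then show ?thesis using False by (metis DiffD1 zero_less_one)
    qed
    then obtain r where r0: "\<And>x. r x > 0"
      and rN: "\<And>x. x \<in> N \<Longrightarrow> ball x (r x) \<subseteq> U"
      and rD: "\<And>x y. x \<in> {c..d} - N \<Longrightarrow> y \<in> {c..d} \<Longrightarrow> norm (y-x) < r x \<Longrightarrow>
                 norm (f y - f x - (y-x) *\<^sub>R g x) \<le> e/2 * norm (y-x)"
      by metis
    show "\<exists>\<gamma>. gauge \<gamma> \<and> (\<forall>p. p tagged_division_of {c..d} \<and> \<gamma> fine p \<longrightarrow>
      norm (sum (\<lambda>(x,k). measure lborel k *\<^sub>R g' x) p - (f d - f c)) \<le> e * measure lborel {c..d})"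
    proof (rule exI, intro conjI allI impI; (elim conjE)?)
      show "gauge (\<lambda>x. ball x (r x))"
        using r0 gauge_ball_dependent by blast
    next
      fix p assume p: "p tagged_division_of {c..d}" and fine: "(\<lambda>x. ball x (r x)) fine p"
      define p1 where "p1 = {(x,K)\<in>p. x \<in> N}"
      have fin: "finite p" using p by (rule tagged_division_ofD(1))
      have sub: "p1 \<subseteq> p" by (auto simp: p1_def)
      have mem: "\<exists>u v. K = {u..v} \<and> u \<le> x \<and> x \<le> v \<and> c \<le> u \<and> v \<le> d" if xK: "(x,K) \<in> p" for x K
      proof -
        obtain u v where K: "K = {u..v}"
          using tagged_division_ofD(4)[OF p xK] by (auto simp: cbox_interval)
        have "x \<in> K" "K \<subseteq> {c..d}"
          using tagged_division_ofD(2,3)[OF p xK] by auto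
        then show ?thesis using K by auto
      qed
      \<comment> \<open>The error on one tagged interval; the increments of \<open>f\<close>
        telescope to \<open>f d - f c\<close>.\<close>
      let ?h = "\<lambda>(x,K). measure lborel K *\<^sub>R g' x - (f (Sup K) - f (Inf K))"
      have "sum (\<lambda>(x,k). measure lborel k *\<^sub>R g' x) p - (f d - f c) = sum ?h p"
        using additive_tagged_division_1[OF \<open>c \<le> d\<close> p, of f]
        by (simp add: case_prod_unfold sum_subtractf)
      also have "\<dots> = sum ?h (p - p1) + sum ?h p1"
        by (rule sum.subset_diff[OF sub fin])
      finally have eq: "sum (\<lambda>(x,k). measure lborel k *\<^sub>R g' x) p - (f d - f c)
        = sum ?h (p - p1) + sum ?h p1" .
      have "norm (sum ?h (p - p1)) \<le> (\<Sum>(x,K)\<in>p - p1. e/2 * (Sup K - Inf K))"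
      proof (rule sum_norm_le, clarify)
        fix x K assume xK: "(x,K) \<in> p" "(x,K) \<notin> p1"
        then have "x \<notin> N" by (simp add: p1_def)
        obtain u v where uv: "K = {u..v}" "u \<le> x" "x \<le> v" "c \<le> u" "v \<le> d"
          using mem[OF xK(1)] by blast
        have "K \<subseteq> ball x (r x)" using fine xK(1) by (rule fineD)
        moreover have "u \<in> K" "v \<in> K" using uv by auto
        ultimately have "u \<in> ball x (r x)" "v \<in> ball x (r x)" by blast+
        then have "norm (u - x) < r x" "norm (v - x) < r x"
          by (simp_all add: dist_real_def abs_minus_commute)
        then have "norm ((v - u) *\<^sub>R g x - (f v - f u)) \<le> e/2 * (v - u)"
          using rD[of x u] rD[of x v] uv \<open>x \<notin> N\<close> by (intro increment_approx_le[of u x v]) auto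
        then show "norm (measure lborel K *\<^sub>R g' x - (f (Sup K) - f (Inf K))) \<le> e/2 * (Sup K - Inf K)"
          using uv \<open>x \<notin> N\<close> by (simp add: g'_def)
      qed
      also have "\<dots> \<le> (\<Sum>(x,K)\<in>p. e/2 * (Sup K - Inf K))"
        using \<open>e > 0\<close> by (intro sum_mono2 fin) (auto dest!: mem)
      also have "\<dots> = e/2 * (d - c)"
        using additive_tagged_division_1[OF \<open>c \<le> d\<close> p, of "\<lambda>x. x"]
        unfolding case_prod_unfold sum_distrib_left[symmetric] by simp
      finally have 1: "norm (sum ?h (p - p1)) \<le> e'" by (simp add: e'_def)
      have p1: "p1 tagged_division_of \<Union>(snd ` p1)"
        by (rule tagged_partial_division_of_Union_self[OF tagged_partial_division_subset[OF _ sub]])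
          (rule p[unfolded tagged_division_of_def, THEN conjunct1])
      then have dv: "snd ` p1 division_of \<Union>(snd ` p1)"
        by (rule division_of_tagged_division)
      have "K \<subseteq> U" if "(x,K) \<in> p1" for x K
        using fineD[OF fine, of x K] rN[of x] that by (auto simp: p1_def)
      then have "\<Union>(snd ` p1) \<subseteq> U" by fastforce
      then have "(\<Sum>K\<in>snd ` p1. Sup K - Inf K) < \<delta>"
        using sum_content_division_le_measure[OF dv _ Um] U\<delta> by simp
      moreover have "\<Union>(snd ` p1) \<subseteq> {c..d}"
        using tagged_division_ofD(3)[OF p] sub by fastforce
      ultimately have less: "(\<Sum>K\<in>snd ` p1. norm (f (Sup K) - f (Inf K))) < e'"
        using \<delta>[rule_format, OF conjI, OF dv] by simp
      have "norm (sum ?h p1) \<le> (\<Sum>(x,K)\<in>p1. norm (f (Sup K) - f (Inf K)))"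
        by (rule sum_norm_le) (auto simp: p1_def g'_def norm_minus_commute)
      \<comment> \<open>Passing from tagged pairs to intervals requires a summand that vanishes on
        every interval with empty interior. \<open>Sup {}\<close> and \<open>Inf {}\<close> are
        unspecified, so the empty interval gets the value 0 explicitly.\<close>
      also have "\<dots> = (\<Sum>(x,K)\<in>p1. if K = {} then 0 else norm (f (Sup K) - f (Inf K)))"
        using tagged_division_ofD(2)[OF p1] by (intro sum.cong) fastforce+
      also have "\<dots> = (\<Sum>K\<in>snd ` p1. if K = {} then 0 else norm (f (Sup K) - f (Inf K)))"
        by (rule sum.over_tagged_division_lemma[OF p1]) (auto simp: not_less)
      also have "\<dots> = (\<Sum>K\<in>snd ` p1. norm (f (Sup K) - f (Inf K)))"
        using tagged_division_ofD(2)[OF p1] by (intro sum.cong) fastforce+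
      finally have 2: "norm (sum ?h p1) \<le> e'" using less by simp
      show "norm (sum (\<lambda>(x,k). measure lborel k *\<^sub>R g' x) p - (f d - f c)) \<le> e * measure lborel {c..d}"
        unfolding eq using norm_triangle_mono[OF 1 2] \<open>c \<le> d\<close> by (simp add: e'_def)
    qed
  qed
  then show ?thesis
    by (rule has_integral_spike[OF N, rotated]) (simp add: g'_def)
qed (simp add: has_integral_refl)

section \<open>Boundedness near the left endpoint\<close>

text \<open>On an interval where \<open>1 \<le> v\<close>, the function \<open>v'\<close> varies by
  at most the integral \<open>G\<close> of \<open>g\<close>. Either \<open>v\<close> stays at least
  1 near \<open>a\<close>, and then its slope is bounded there; or \<open>v\<close> falls below 1
  arbitrarily close to \<open>a\<close>, and then a large value lies under an interior maximum, from
  which \<open>v\<close> descends to 1 with mean slope at least \<open>- G\<close>.\<close>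

lemma bounded_near_left_endpoint:
  fixes v v' v'' g :: "real \<Rightarrow> real"
  assumes "a < b"
    and der: "\<And>x. a < x \<Longrightarrow> (v has_real_derivative v' x) (at x)"
    and ftc: "\<And>c d. a < c \<Longrightarrow> c \<le> d \<Longrightarrow> (v'' has_integral (v' d - v' c)) {c..d}"
    and g: "g integrable_on {a<..}" "\<And>x. a < x \<Longrightarrow> 0 \<le> g x"
    and bound: "\<And>x. a < x \<Longrightarrow> 1 \<le> v x \<Longrightarrow> \<bar>v'' x\<bar> \<le> g x"
  shows "\<exists>B. \<forall>x\<in>{a<..b}. v x \<le> B"
proof -
  define G where "G = integral {a<..} g"
  have "G \<ge> 0" unfolding G_def using g by (intro integral_nonneg) auto
  have v'_diff: "\<bar>v' d - v' c\<bar> \<le> G"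
    if "a < c" "c \<le> d" and ge: "\<And>x. c \<le> x \<Longrightarrow> x \<le> d \<Longrightarrow> 1 \<le> v x" for c d
  proof -
    have gi: "g integrable_on {c..d}"
      by (rule integrable_on_subinterval[OF g(1)]) (use that in auto)
    have "norm (integral {c..d} v'') \<le> integral {c..d} g"
      using ftc[OF that(1,2)] gi bound ge \<open>a < c\<close> by (intro integral_norm_bound_integral) auto
    also have "\<dots> \<le> G" unfolding G_def
      using g gi that by (intro integral_subset_le) auto
    finally show ?thesis using ftc[OF that(1,2)] by (simp add: integral_unique)
  qed
  have cont: "continuous_on S v" if "S \<subseteq> {a<..}" for S
    using der that by (meson DERIV_isCont continuous_at_imp_continuous_on greaterThan_iff subset_iff)
  have mvt: "\<exists>\<xi>>x. \<xi> < y \<and> v y - v x = (y - x) * v' \<xi>" if "a < x" "x < y" for x y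
    using MVT2[of x y v v'] der that by auto
  have "\<exists>c B. a < c \<and> c \<le> b \<and> (\<forall>x\<in>{a<..c}. v x \<le> B)"
  proof (cases "\<exists>c>a. \<forall>x\<in>{a<..c}. 1 \<le> v x")
    case True
    then obtain c0 where c0: "c0 > a" "\<forall>x\<in>{a<..c0}. 1 \<le> v x" by blast
    define c where "c = min c0 b"
    have c: "a < c" "c \<le> b" "\<And>x. a < x \<Longrightarrow> x \<le> c \<Longrightarrow> 1 \<le> v x"
      using c0 \<open>a < b\<close> by (auto simp: c_def)
    have "v x \<le> v c + (c - a) * (G + \<bar>v' c\<bar>)" if x: "a < x" "x < c" for x
    proof -
      obtain \<xi> where xi: "x < \<xi>" "\<xi> < c" "v c - v x = (c - x) * v' \<xi>"
        using mvt x by blast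
      have "\<bar>v' c - v' \<xi>\<bar> \<le> G" using xi x c by (intro v'_diff) auto
      then have "- v' \<xi> \<le> G + \<bar>v' c\<bar>" by linarith
      then have "(c - x) * (- v' \<xi>) \<le> (c - x) * (G + \<bar>v' c\<bar>)"
        using x by (intro mult_left_mono) auto
      also have "\<dots> \<le> (c - a) * (G + \<bar>v' c\<bar>)"
        using x \<open>G \<ge> 0\<close> by (intro mult_right_mono) auto
      finally have "(c - x) * (- v' \<xi>) \<le> (c - a) * (G + \<bar>v' c\<bar>)" .
      then show ?thesis using xi by (simp add: algebra_simps)
    qed
    moreover have "v c \<le> v c + (c - a) * (G + \<bar>v' c\<bar>)"
      using c \<open>G \<ge> 0\<close> by simp
    ultimately have "\<forall>x\<in>{a<..c}. v x \<le> v c + (c - a) * (G + \<bar>v' c\<bar>)"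
      by (metis greaterThanAtMost_iff le_less)
    then show ?thesis using c by blast
  next
    case False
    then have small: "\<exists>x>a. x \<le> c \<and> v x < 1" if "a < c" for c
      using that by (metis greaterThanAtMost_iff not_le)
    then obtain c where c: "a < c" "c \<le> b" "v c < 1" using \<open>a < b\<close> by blast
    have "v x0 \<le> 1 + (c - a) * G" if x0: "a < x0" "x0 \<le> c" for x0
    proof (cases "v x0 \<le> 1")
      case True
      then show ?thesis using c \<open>G \<ge> 0\<close> by (simp add: add_increasing2)
    next
      case False
      obtain x where x: "a < x" "x \<le> x0" "v x < 1" using small x0 by blast
      \<comment> \<open>\<open>v\<close> is below 1 at both ends \<open>x\<close> and
        \<open>c\<close> but above 1 at \<open>x0\<close>, so the maximum is interior and
        \<open>v'\<close> vanishes there.\<close>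
      have "\<exists>m\<in>{x..c}. \<forall>t\<in>{x..c}. v t \<le> v m"
        by (rule continuous_attains_sup) (use x x0 in \<open>auto intro!: cont\<close>)
      then obtain m where m: "m \<in> {x..c}" "\<And>t. t \<in> {x..c} \<Longrightarrow> v t \<le> v m" by blast
      have "v x0 \<le> v m" using m x x0 by auto
      then have "m \<noteq> x" "m \<noteq> c" using x c False by auto
      then have mi: "x < m" "m < c" using m(1) by auto
      have "v' m = 0"
      proof (rule DERIV_local_max[of v "v' m" m])
        show "(v has_real_derivative v' m) (at m)" using der mi x by simp
        show "0 < min (m - x) (c - m)" using mi by simp
        show "\<forall>y. \<bar>m - y\<bar> < min (m - x) (c - m) \<longrightarrow> v y \<le> v m"
          using m(2) by (auto simp: abs_less_iff)
      qed
      \<comment> \<open>The least element \<open>d\<close> of \<open>S\<close> is the first point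
        after \<open>m\<close> with \<open>v d \<le> 1\<close>; before it \<open>v\<close> exceeds
        1, so \<open>v'_diff\<close> applies from \<open>m\<close> up to the mean value
        point.\<close>
      define S where "S = {m..c} \<inter> v -` {..1}"
      have "closed S" unfolding S_def
        by (intro continuous_closed_preimage cont) (use mi x in auto)
      moreover have "bounded S"
        using bounded_subset[of "{m..c}" S] by (auto simp: S_def)
      ultimately have "compact S" by (simp add: compact_eq_bounded_closed)
      moreover have "c \<in> S" using mi c by (simp add: S_def)
      ultimately obtain d where d: "d \<in> S" "\<And>t. t \<in> S \<Longrightarrow> d \<le> t"
        using compact_attains_inf[of S] by blast
      have "m \<noteq> d" using d(1) \<open>v x0 \<le> v m\<close> False by (auto simp: S_def)
      then have "m < d" using d(1) by (simp add: S_def)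
      then obtain \<xi> where xi: "m < \<xi>" "\<xi> < d" "v d - v m = (d - m) * v' \<xi>"
        using mvt[of m d] mi x by auto
      have "1 \<le> v t" if "m \<le> t" "t \<le> \<xi>" for t
      proof (rule ccontr)
        assume "\<not> 1 \<le> v t"
        then have "t \<in> S" using that xi d(1) by (auto simp: S_def)
        then show False using d(2)[of t] that xi by simp
      qed
      then have "\<bar>v' \<xi> - v' m\<bar> \<le> G" using xi mi x by (intro v'_diff) auto
      then have "- v' \<xi> \<le> G" using \<open>v' m = 0\<close> by simp
      then have "(d - m) * (- v' \<xi>) \<le> (d - m) * G"
        using \<open>m < d\<close> by (intro mult_left_mono) auto
      also have "\<dots> \<le> (c - a) * G"
        using d(1) mi x \<open>G \<ge> 0\<close> by (intro mult_right_mono) (auto simp: S_def)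
      finally show ?thesis using xi \<open>v x0 \<le> v m\<close> d(1) by (simp add: S_def algebra_simps)
    qed
    then have "\<forall>x\<in>{a<..c}. v x \<le> 1 + (c - a) * G" by simp
    then show ?thesis using c by blast
  qed
  then obtain c B where c: "a < c" "c \<le> b" "\<forall>x\<in>{a<..c}. v x \<le> B" by blast
  have "\<exists>m\<in>{c..b}. \<forall>t\<in>{c..b}. v t \<le> v m"
    by (rule continuous_attains_sup) (use c in \<open>auto intro!: cont\<close>)
  then obtain m where "\<forall>t\<in>{c..b}. v t \<le> v m" by blast
  then have "\<forall>x\<in>{a<..b}. v x \<le> max B (v m)"
    using c by (metis atLeastAtMost_iff greaterThanAtMost_iff le_max_iff_disj linear)
  then show ?thesis by blast
qed

section \<open>Non-integrability from a power bound\<close>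

text \<open>The minorant \<open>h\<close> of \<open>g\<close> given by Bernoulli's inequality has
  the primitive \<open>H\<close>, since \<open>q\<close> is the derivative of \<open>Q\<close>. As
  \<open>H b \<ge> \<delta> * b\<close> for \<open>b \<ge> 0\<close>, the integrals of
  \<open>g\<close> over \<open>{X..b}\<close> are unbounded.\<close>

lemma not_integrable_of_power_bound:
  fixes q r Q g :: "real \<Rightarrow> real" and N :: nat
  assumes "\<delta> > 0" and pos: "\<And>x. X \<le> x \<Longrightarrow> 0 < q x" "\<And>x. X \<le> x \<Longrightarrow> 0 < r x"
    and r: "\<And>x. X \<le> x \<Longrightarrow> \<delta> * r x \<le> q x ^ N"
    and Q: "\<And>x. X \<le> x \<Longrightarrow> 0 \<le> Q x"
    and der: "\<And>x b. X \<le> x \<Longrightarrow> x \<le> b \<Longrightarrow> (Q has_real_derivative q x) (at x within {X..b})"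
    and g: "\<And>x. X \<le> x \<Longrightarrow> exp (2 * Q x) / r x \<le> g x"
  shows "\<not> g integrable_on {X..}"
proof
  assume int: "g integrable_on {X..}"
  \<comment> \<open>What matters is \<open>k > 0\<close> and \<open>N * k \<le> 2\<close>; the
    denominator \<open>N + 1\<close> also covers \<open>N = 0\<close>.\<close>
  define k :: real where "k = 2 / (real N + 1)"
  have "k > 0" by (simp add: k_def)
  define h where "h x = \<delta> * (real N + 1 - real N * (q x * exp (- k * Q x)))" for x
  define H where "H x = \<delta> * ((real N + 1) * x + real N / k * exp (- k * Q x))" for x
  have h_le: "h x \<le> g x" if "X \<le> x" for x
  proof -
    define t where "t = q x * exp (- k * Q x)"
    have "t > 0" using pos that by (simp add: t_def)
    have "real N + 1 - real N * t \<le> 1 / t ^ N"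
    proof -
      have "1 - real N * (t - 1) \<le> (1 / t) ^ N"
      proof -
        \<comment> \<open>This is \<open>t + 1 / t \<ge> 2\<close>; it leads from the bound linear
          in \<open>t\<close> to Bernoulli's inequality for \<open>1 / t\<close>.\<close>
        have *: "1 - t \<le> 1 / t - 1"
        proof -
          have "0 \<le> (1 - t)\<^sup>2 / t" using \<open>t > 0\<close> by simp
          also have "(1 - t)\<^sup>2 / t = 1 / t - 1 - (1 - t)"
            using \<open>t > 0\<close> by (simp add: field_simps power2_eq_square)
          finally show ?thesis by simp
        qed
        have "1 - real N * (t - 1) \<le> 1 + real N * (1 / t - 1)"
          using mult_left_mono[OF *, of "real N"] by (simp add: algebra_simps)
        also have "\<dots> \<le> (1 + (1 / t - 1)) ^ N"
          using \<open>t > 0\<close> by (intro Bernoulli_inequality) simp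
        finally show ?thesis by simp
      qed
      then show ?thesis by (simp add: power_divide algebra_simps)
    qed
    also have "1 / t ^ N = exp (real N * k * Q x) / q x ^ N"
      by (simp add: t_def power_mult_distrib exp_minus divide_simps mult_ac flip: exp_of_nat_mult)
    also have "\<dots> \<le> exp (2 * Q x) / (\<delta> * r x)"
    proof (rule frac_le)
      have "real N * k \<le> 2" by (simp add: k_def field_simps)
      then show "exp (real N * k * Q x) \<le> exp (2 * Q x)"
        using Q[OF that] by (simp add: mult_right_mono)
    qed (use that \<open>\<delta> > 0\<close> pos r in auto)
    finally have "h x \<le> exp (2 * Q x) / r x"
      using \<open>\<delta> > 0\<close> pos(2)[OF that] by (simp add: h_def t_def field_simps)
    then show ?thesis using g[OF that] by linarith
  qed
  have g0: "0 \<le> g x" if "X \<le> x" for x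
    using g[OF that] pos(2)[OF that] by (meson divide_nonneg_pos exp_ge_zero order_trans)
  \<comment> \<open>Chosen so that \<open>\<delta> * b\<close> exceeds
    \<open>H X + integral {X..} g\<close> while \<open>b\<close> is at least
    \<open>\<bar>X\<bar>\<close>.\<close>
  define b where "b = \<bar>X\<bar> + (\<bar>H X\<bar> + \<bar>integral {X..} g\<bar> + 1) / \<delta>"
  have b: "\<delta> * b = \<delta> * \<bar>X\<bar> + \<bar>H X\<bar> + \<bar>integral {X..} g\<bar> + 1"
    using \<open>\<delta> > 0\<close> by (simp add: b_def field_simps)
  have "\<bar>X\<bar> \<le> b" using \<open>\<delta> > 0\<close> by (simp add: b_def)
  then have "X \<le> b" "0 \<le> b" by auto
  have "(h has_integral (H b - H X)) {X..b}"
  proof (rule fundamental_theorem_of_calculus[OF \<open>X \<le> b\<close>])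
    fix x assume "x \<in> {X..b}"
    then have "(Q has_real_derivative q x) (at x within {X..b})" using der by simp
    then show "(H has_vector_derivative h x) (at x within {X..b})"
      unfolding H_def h_def has_real_derivative_iff_has_vector_derivative[symmetric]
      using \<open>k > 0\<close> by (auto intro!: derivative_eq_intros)
  qed
  moreover have gb: "g integrable_on {X..b}"
    by (rule integrable_on_subinterval[OF int]) auto
  ultimately have "H b - H X \<le> integral {X..b} g"
    using h_le by (intro has_integral_le[OF _ integrable_integral]) auto
  also have "\<dots> \<le> integral {X..} g"
    using gb int g0 by (intro integral_subset_le) auto
  finally have le: "H b - H X \<le> integral {X..} g" .
  have "\<delta> * b \<le> \<delta> * ((real N + 1) * b + real N / k * exp (- k * Q b))"
    using \<open>\<delta> > 0\<close> \<open>k > 0\<close> \<open>0 \<le> b\<close> by (intro mult_left_mono) (auto simp: algebra_simps)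
  then have "\<delta> * b \<le> H b" by (simp add: H_def)
  moreover have "0 \<le> \<delta> * \<bar>X\<bar>" using \<open>\<delta> > 0\<close> by simp
  ultimately show False using le b by linarith
qed

section \<open>Integration of the second derivative; principal powers\<close>

lemma AC_loc_derivs_has_integral:
  assumes f: "AC_loc_derivs a f f' f''" and "a < c" "c \<le> d"
  shows "(f'' has_integral (f' d - f' c)) {c..d}"
proof -
  have "AE x in lebesgue. a < x \<longrightarrow> (f' has_vector_derivative f'' x) (at x)"
    using f by (simp add: AC_loc_derivs_def)
  then obtain N where N: "N \<in> null_sets lebesgue"
      "{x \<in> space lebesgue. \<not> (a < x \<longrightarrow> (f' has_vector_derivative f'' x) (at x))} \<subseteq> N"
    unfolding eventually_ae_filter by blast
  show ?thesis
  proof (rule has_integral_abs_continuous_derivative)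
    show "abs_continuous_on {c..d} f'"
      using f assms(2,3) by (simp add: AC_loc_derivs_def AC_loc_def)
    show "negligible N" using N(1) by (simp add: negligible_iff_null_sets)
    show "(f' has_vector_derivative f'' x) (at x within {c..d})" if "x \<in> {c..d} - N" for x
    proof -
      have "x \<notin> {x \<in> space lebesgue. \<not> (a < x \<longrightarrow> (f' has_vector_derivative f'' x) (at x))}"
        using that N(2) by blast
      moreover have "a < x" using that \<open>a < c\<close> by simp
      ultimately have "(f' has_vector_derivative f'' x) (at x)" by simp
      then show ?thesis by (rule has_vector_derivative_at_within)
    qed
  qed fact
qed

lemma Re_powr_of_real:
  assumes "z \<noteq> 0"
  shows "Re (z powr of_real t) = norm z powr t * cos (t * Arg z)"
  using assms by (simp add: powr_def Re_exp Arg_eq_Im_Ln)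

text \<open>Bounding the norm by the real part reduces bounds on \<open>u\<close> to a real
  function. The last identity expresses the square root of \<open>s\<close> through
  \<open>u\<close>, from which it inherits continuity.\<close>

lemma powr_neg_quarter:
  fixes z :: complex
  assumes "z \<noteq> 0"
  shows norm_powr_neg_quarter: "(norm (z powr (- 1 / 4)))\<^sup>2 = norm z powr (- 1 / 2)"
    and norm_powr_neg_quarter_le: "norm (z powr (- 1 / 4)) \<le> 2 * Re (z powr (- 1 / 4))"
    and powr_half_conv_neg_quarter: "z powr (1 / 2) = inverse ((z powr (- 1 / 4))\<^sup>2)"
proof -
  have norm: "norm (z powr (- 1 / 4)) = norm z powr (- 1 / 4)"
    using assms by (simp add: norm_powr_complex)
  then show "(norm (z powr (- 1 / 4)))\<^sup>2 = norm z powr (- 1 / 2)"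
    using assms by (simp add: powr_def flip: exp_of_nat_mult)
  \<comment> \<open>The angle is in fact at most \<open>pi / 4\<close>; the larger
    \<open>pi / 3\<close> has cosine exactly 1/2, whence the factor 2.\<close>
  have "\<bar>Arg z / 4\<bar> \<le> pi / 3"
    using Arg_bounded[of z] pi_gt_zero by linarith
  then have "cos (pi / 3) \<le> cos \<bar>Arg z / 4\<bar>"
    by (intro cos_monotone_0_pi_le) auto
  then have "1 / 2 \<le> cos (- 1 / 4 * Arg z)"
    unfolding cos_abs_real by (simp add: cos_60)
  moreover have "Re (z powr (- 1 / 4)) = norm z powr (- 1 / 4) * cos (- 1 / 4 * Arg z)"
    using Re_powr_of_real[OF assms, of "- 1 / 4"] by simp
  ultimately show "norm (z powr (- 1 / 4)) \<le> 2 * Re (z powr (- 1 / 4))"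
    using mult_left_mono[of "1 / 2" "cos (- 1 / 4 * Arg z)" "norm z powr (- 1 / 4)"]
    unfolding norm by simp
  show "z powr (1 / 2) = inverse ((z powr (- 1 / 4))\<^sup>2)"
  proof -
    have "exp (Ln z / 2) = (exp (Ln z / 4))\<^sup>2"
      using exp_double[of "Ln z / 4"] by simp
    then show ?thesis using assms by (simp add: powr_def exp_minus power_inverse)
  qed
qed

lemma Re_powr_half_pos:
  assumes "z \<noteq> 0" "Arg z \<noteq> pi"
  shows "0 < Re (z powr (1 / 2))"
proof -
  have "Re (z powr (1 / 2)) = norm z powr (1 / 2) * cos (Arg z / 2)"
    using Re_powr_of_real[OF assms(1), of "1 / 2"] by simp
  moreover have "0 < cos (Arg z / 2)"
    using Arg_bounded[of z] assms(2) by (intro cos_gt_zero_pi) auto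
  ultimately show ?thesis using assms(1) by simp
qed

theorem theorem4p4:
  fixes a :: real
    and s u u' u'' y yh F Fh :: "real \<Rightarrow> complex"
  assumes "L1_loc a s"
    and "\<And>x. x \<ge> a \<Longrightarrow> s x \<noteq> 0 \<and> Arg (s x) \<noteq> pi"
    and "u = (\<lambda>x. s x powr (- 1 / 4))"
    and "AC_loc_derivs a u u' u''"
    and "(\<lambda>x. u x * u'' x) absolutely_integrable_on {a<..}"
    and "fundamental_system a s y yh"
    and "\<And>x. x \<ge> a \<Longrightarrow>
           y x = s x powr (- 1 / 4) * exp (- (LINT t:{a..x}|lebesgue. s t powr (1 / 2))) * (1 + F x)"
    and "\<And>x. x \<ge> a \<Longrightarrow>
           yh x = s x powr (- 1 / 4) * exp (LINT t:{a..x}|lebesgue. s t powr (1 / 2)) * (1 + Fh x)"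
    and "bounded (F ` {a..})" and "bounded (Fh ` {a..})"
    and "(F \<longlongrightarrow> 0) at_top" and "(Fh \<longlongrightarrow> 0) at_top"
    and "\<not> (\<lambda>x. norm (s x) powr (- 1 / 2)) absolutely_integrable_on {a..}
       \<or> Linf_on {a..} s
       \<or> ((\<integral>\<^sup>+x\<in>{a..}. ennreal (Re (s x powr (1 / 2))) \<partial>lebesgue) < \<infinity> \<and>
          Liminf at_top (\<lambda>x. ereal (Re (s x powr (1 / 2)) / norm (s x) powr (1 / 2))) > 0)
       \<or> ((\<integral>\<^sup>+x\<in>{a..}. ennreal (Re (s x powr (1 / 2))) \<partial>lebesgue) = \<infinity> \<and>
          (\<exists>N::nat. Liminf at_top (\<lambda>x. ereal (Re (s x powr (1 / 2)) ^ N / norm (s x powr (1 / 2)))) > 0))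
       \<or> (\<exists>\<epsilon>\<^sub>0>0. \<forall>x\<ge>a. \<bar>Arg (s x)\<bar> \<le> pi - \<epsilon>\<^sub>0)"
  shows "\<not> L2_on {a..} yh"
proof
  assume L2: "L2_on {a..} yh"
  note s1 = assms(1) and s0 = assms(2) and u = assms(3) and ac = assms(4) and uu = assms(5)
    and yh = assms(8) and Fh = assms(12) and cases = assms(13)

  \<comment> \<open>Continuity and local integrability of the square root of
    \<open>s\<close>\<close>
  define p where "p x = s x powr (1 / 2)" for x
  define q where "q x = Re (p x)" for x
  define r where "r x = norm (s x) powr (1 / 2)" for x
  define Q where "Q x = Re (LINT t:{a..x}|lebesgue. p t)" for x
  have norm_p: "norm (p x) = r x" for x
    by (simp add: p_def r_def norm_powr_real_powr')
  have r_sq: "(r x)\<^sup>2 = norm (s x)" and r_nonneg: "0 \<le> r x" for x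
    by (simp_all add: r_def powr_half_sqrt)
  have r_pos: "0 < r x" and q_pos: "0 < q x" if "a \<le> x" for x
    using s0[OF that] Re_powr_half_pos by (simp_all add: r_def q_def p_def)
  have norm_u: "(norm (u x))\<^sup>2 = norm (s x) powr (- 1 / 2)" if "a \<le> x" for x
    using s0[OF that] norm_powr_neg_quarter by (simp add: u)
  then have norm_u_r: "(norm (u x))\<^sup>2 = 1 / r x" if "a \<le> x" for x
    using that by (simp add: r_def powr_minus_divide)
  have u0: "u x \<noteq> 0" if "a \<le> x" for x
    using s0[OF that] by (simp add: u)

  have cont_u: "continuous_on {a<..} u"
    using ac unfolding AC_loc_derivs_def
    by (auto intro!: continuous_at_imp_continuous_on has_vector_derivative_continuous)
  \<comment> \<open>Continuity of \<open>p\<close> comes from that of \<open>u\<close>, as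
    \<open>p\<close> is the inverse square of \<open>u\<close>; this bypasses continuity of
    \<open>s\<close> and gives the open half-line only.\<close>
  have "continuous_on {a<..} (\<lambda>x. inverse ((u x)\<^sup>2))"
    using u0 by (intro continuous_intros cont_u) auto
  then have cont_p: "continuous_on {a<..} p"
    by (rule continuous_on_cong[THEN iffD1, rotated 2])
       (use s0 powr_half_conv_neg_quarter in \<open>auto simp: u p_def\<close>)
  have cont_q: "continuous_on {a<..} q"
    unfolding q_def by (intro continuous_intros cont_p)
  have cont_r: "continuous_on {a<..} r"
    unfolding norm_p[symmetric] by (intro continuous_intros cont_p)

  have neg: "negligible {x \<in> {a<..b} - {a..b}. f x \<noteq> 0}" "negligible {x \<in> {a..b} - {a<..b}. f x \<noteq> 0}"
    for b and f :: "real \<Rightarrow> complex"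
    by (auto intro: negligible_subset[of "{a}"])
  \<comment> \<open>Measurability comes from continuity to the right of \<open>a\<close>, the point
    \<open>a\<close> being null; domination comes from \<open>norm (p x) = r x\<close> and
    \<open>(r x - 1)\<^sup>2 \<ge> 0\<close>.\<close>
  have p_int: "p absolutely_integrable_on {a..b}" if "a \<le> b" for b
  proof -
    have "p absolutely_integrable_on {a<..b}"
    proof (rule measurable_bounded_by_integrable_imp_absolutely_integrable)
      show "p \<in> borel_measurable (lebesgue_on {a<..b})"
        by (intro continuous_imp_measurable_on_sets_lebesgue continuous_on_subset[OF cont_p]) auto
      have "s absolutely_integrable_on {a..b}" using s1 that by (simp add: L1_loc_def)
      then have "s absolutely_integrable_on {a<..b}"
        by (rule set_integrable_subset) auto
      then show "(\<lambda>x. 1 + norm (s x)) integrable_on {a<..b}"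
        by (intro integrable_add integrable_on_const) (auto simp: absolutely_integrable_on_def intro: bounded_set_imp_lmeasurable)
      show "norm (p x) \<le> 1 + norm (s x)" for x
      proof -
        have "0 \<le> (r x - 1)\<^sup>2" by simp
        also have "\<dots> = norm (s x) - 2 * r x + 1" by (simp add: power2_diff r_sq)
        finally show ?thesis using r_nonneg[of x] norm_p[of x] by linarith
      qed
    qed auto
    then show ?thesis by (subst absolutely_integrable_spike_set_eq[OF neg(2,1)])
  qed
  have "(q has_integral Q b) {a..b}" if "a \<le> b" for b
  proof -
    have "(p has_integral (LINT t:{a..b}|lebesgue. p t)) {a..b}"
      unfolding has_integral_iff
      using set_lebesgue_integral_eq_integral[OF p_int[OF that]] by simp
    then show ?thesis unfolding q_def Q_def by (rule has_integral_Re)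
  qed
  then have q_int: "q integrable_on {a..b}" and Q_eq: "Q b = integral {a..b} q" if "a \<le> b" for b
    using that by (simp_all add: has_integral_iff)
  have Q_nonneg: "0 \<le> Q x" if "a \<le> x" for x
    unfolding Q_eq[OF that] using q_pos by (intro integral_nonneg q_int that) (auto intro: less_imp_le)
  have Q_der: "(Q has_real_derivative q x) (at x within {X..b})"
    if "a < X" "X \<le> x" "x \<le> b" for x X b
  proof -
    \<comment> \<open>Continuity of \<open>q\<close> is known only to the right of \<open>a\<close>,
      so the integral is restarted at \<open>X > a\<close> and the constant \<open>Q X\<close> is
      added.\<close>
    have "continuous_on {X..b} q"
      using that by (intro continuous_on_subset[OF cont_q]) auto
    then have der: "((\<lambda>x. integral {X..x} q) has_real_derivative q x) (at x within {X..b})"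
      using that by (intro integral_has_real_derivative) auto
    have der': "((\<lambda>x. Q X + integral {X..x} q) has_real_derivative q x) (at x within {X..b})"
      using DERIV_add[OF DERIV_const[of "Q X"] der] by simp
    have Q: "Q X + integral {X..y} q = Q y" if "y \<in> {X..b}" for y
    proof -
      have le: "a \<le> X" "X \<le> y" "a \<le> y" using that \<open>a < X\<close> by auto
      show ?thesis
        unfolding Q_eq[OF le(1)] Q_eq[OF le(3)]
        by (rule Henstock_Kurzweil_Integration.integral_combine[OF le(1,2) q_int[OF le(3)]])
    qed
    show ?thesis
      by (rule has_field_derivative_transform_within[OF der' zero_less_one _ Q]) (use that in simp_all)
  qed

  \<comment> \<open>Lower bound for \<open>yh\<close> and its consequence for power bounds\<close>
  obtain X0 where X0: "\<And>x. X0 \<le> x \<Longrightarrow> norm (Fh x) < 1 / 2"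
    using tendstoD[OF Fh, of "1 / 2"] by (auto simp: eventually_at_top_linorder)
  define X1 where "X1 = max X0 (a + 1)"
  have X1: "a < X1" by (simp add: X1_def)
  have lower: "exp (2 * Q x) / r x \<le> 4 * (norm (yh x))\<^sup>2" if "X1 \<le> x" for x
  proof -
    have ax: "a \<le> x" using that X1 by simp
    \<comment> \<open>The bound 1/2, once squared, is the source of the factor 4.\<close>
    have "1 / 2 \<le> norm (1 + Fh x)"
      using norm_triangle_ineq2[of 1 "- Fh x"] X0[of x] that by (simp add: X1_def)
    then have "(1 / 2)\<^sup>2 \<le> (norm (1 + Fh x))\<^sup>2" by (intro power_mono) auto
    then have F: "1 \<le> 4 * (norm (1 + Fh x))\<^sup>2" by (simp add: power2_eq_square)
    have "norm (yh x) = norm (u x) * exp (Q x) * norm (1 + Fh x)"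
      by (simp add: yh[OF ax] norm_mult u Q_def p_def)
    then have "(norm (yh x))\<^sup>2 = exp (2 * Q x) / r x * (norm (1 + Fh x))\<^sup>2"
      by (simp add: power_mult_distrib norm_u_r[OF ax] exp_double)
    then show ?thesis
      using mult_left_mono[OF F, of "exp (2 * Q x) / r x"] r_pos[OF ax] by (simp add: mult_ac)
  qed
  have yh_int: "(\<lambda>x. 4 * (norm (yh x))\<^sup>2) integrable_on {X..}" if "a \<le> X" for X
  proof -
    have "(\<lambda>x. (norm (yh x))\<^sup>2) absolutely_integrable_on {a..}"
      using L2 by (simp add: L2_on_def)
    then have "(\<lambda>x. (norm (yh x))\<^sup>2) absolutely_integrable_on {X..}"
      by (rule set_integrable_subset) (use that in auto)
    then show ?thesis
      by (intro integrable_on_mult_right set_lebesgue_integral_eq_integral(1))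
  qed

  \<comment> \<open>The common end of cases (b) to (e): an eventual bound of \<open>r\<close> by a
    power of \<open>q\<close> contradicts square integrability of \<open>yh\<close>.\<close>
  have power: False
    if "\<delta> > 0" and ev: "eventually (\<lambda>x. \<delta> * r x \<le> q x ^ N) at_top" for \<delta> and N :: nat
  proof -
    obtain X2 where X2: "\<And>x. X2 \<le> x \<Longrightarrow> \<delta> * r x \<le> q x ^ N"
      using ev by (auto simp: eventually_at_top_linorder)
    define X where "X = max X1 X2"
    have "\<not> (\<lambda>x. 4 * (norm (yh x))\<^sup>2) integrable_on {X..}"
      by (rule not_integrable_of_power_bound[of \<delta> X q r N Q])
        (use X1 X2 \<open>\<delta> > 0\<close> q_pos r_pos Q_nonneg Q_der lower in \<open>auto simp: X_def\<close>)
    then show False using yh_int X1 by (simp add: X_def)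
  qed

  \<comment> \<open>Case (a): integrability of the squared norm of \<open>u\<close>\<close>
  have integrable: "(\<lambda>x. norm (s x) powr (- 1 / 2)) absolutely_integrable_on {a..}"
  proof -
    let ?w = "\<lambda>x. (norm (u x))\<^sup>2"
    have cont_w: "continuous_on {a<..} ?w" by (intro continuous_intros cont_u)
    have "\<exists>B. \<forall>x\<in>{a<..X1}. Re (u x) \<le> B"
    proof (rule bounded_near_left_endpoint[OF X1])
      show "((\<lambda>x. Re (u x)) has_real_derivative Re (u' x)) (at x)" if "a < x" for x
        using ac that unfolding AC_loc_derivs_def has_real_derivative_iff_has_vector_derivative
        by (auto intro: bounded_linear.has_vector_derivative[OF bounded_linear_Re])
      show "((\<lambda>x. Re (u'' x)) has_integral Re (u' d) - Re (u' c)) {c..d}" if "a < c" "c \<le> d" for c d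
        using has_integral_Re[OF AC_loc_derivs_has_integral[OF ac that]] by simp
      show "(\<lambda>x. norm (u x * u'' x)) integrable_on {a<..}"
        using uu by (simp add: absolutely_integrable_on_def)
      show "\<bar>Re (u'' x)\<bar> \<le> norm (u x * u'' x)" if "1 \<le> Re (u x)" for x
      proof -
        have "1 \<le> norm (u x)" using that complex_Re_le_cmod[of "u x"] by linarith
        then have "norm (u'' x) \<le> norm (u x * u'' x)"
          by (simp add: norm_mult mult_le_cancel_right1)
        then show ?thesis using abs_Re_le_cmod[of "u'' x"] by linarith
      qed
    qed auto
    then obtain B where B: "\<forall>x\<in>{a<..X1}. Re (u x) \<le> B" by blast
    have "?w absolutely_integrable_on {a<..X1}"
    proof (rule measurable_bounded_by_integrable_imp_absolutely_integrable)
      show "?w \<in> borel_measurable (lebesgue_on {a<..X1})"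
        by (intro continuous_imp_measurable_on_sets_lebesgue continuous_on_subset[OF cont_w]) auto
      show "(\<lambda>x. (2 * B)\<^sup>2) integrable_on {a<..X1}"
        by (intro integrable_on_const bounded_set_imp_lmeasurable) auto
      show "norm (?w x) \<le> (2 * B)\<^sup>2" if "x \<in> {a<..X1}" for x
      proof -
        have "norm (u x) \<le> 2 * Re (u x)"
          using s0[of x] norm_powr_neg_quarter_le that by (simp add: u)
        then have "norm (u x) \<le> 2 * B" using B that by fastforce
        then show ?thesis using power_mono[of "norm (u x)" "2 * B" 2] by simp
      qed
    qed auto
    \<comment> \<open>Beyond \<open>X1\<close>, \<open>Q \<ge> 0\<close> gives
      \<open>1 / r x \<le> exp (2 * Q x) / r x\<close>, so \<open>lower\<close> provides the
      majorant.\<close>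
    moreover have "?w absolutely_integrable_on {X1..}"
    proof (rule measurable_bounded_by_integrable_imp_absolutely_integrable)
      show "?w \<in> borel_measurable (lebesgue_on {X1..})"
        using X1 by (intro continuous_imp_measurable_on_sets_lebesgue continuous_on_subset[OF cont_w]) auto
      show "(\<lambda>x. 4 * (norm (yh x))\<^sup>2) integrable_on {X1..}" using yh_int X1 by simp
      show "norm (?w x) \<le> 4 * (norm (yh x))\<^sup>2" if "x \<in> {X1..}" for x
      proof -
        have "1 / r x \<le> exp (2 * Q x) / r x"
          using Q_nonneg[of x] r_pos[of x] X1 that by (simp add: divide_right_mono)
        then show ?thesis using lower[of x] norm_u_r[of x] r_nonneg[of x] X1 that by simp
      qed
    qed auto
    ultimately have "?w absolutely_integrable_on ({a<..X1} \<union> {X1..})"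
      by (rule absolutely_integrable_Un)
    moreover have "{a<..X1} \<union> {X1..} = {a<..}" using X1 by auto
    ultimately have w: "?w absolutely_integrable_on {a<..}" by simp
    have "?w absolutely_integrable_on {a..}"
      by (rule absolutely_integrable_spike_set_eq[THEN iffD2, OF _ _ w];
          rule negligible_subset[of "{a}"]; force)
    then show ?thesis
      by (subst set_integrable_cong[of lebesgue lebesgue _ _ _ ?w]) (simp_all add: norm_u)
  qed

  \<comment> \<open>Cases (b) to (e): verification of the power bound\<close>
  have norm_p': "norm (s x powr (1 / 2)) = norm (s x) powr (1 / 2)" for x
    using norm_p[of x] by (simp add: p_def r_def)
  \<comment> \<open>The quotient in (c) is written with exponent 1, which makes (c) an instance of
    \<open>liminf\<close>.\<close>
  consider
      (b) "Linf_on {a..} s"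
    | (c) "Liminf at_top (\<lambda>x. ereal (q x ^ 1 / r x)) > 0"
    | (d) N where "Liminf at_top (\<lambda>x. ereal (q x ^ N / r x)) > 0"
    | (e) \<epsilon> where "\<epsilon> > 0" "\<forall>x\<ge>a. \<bar>Arg (s x)\<bar> \<le> pi - \<epsilon>"
    using cases integrable unfolding q_def r_def p_def norm_p' power_one_right by blast
  moreover have liminf: False if L: "Liminf at_top (\<lambda>x. ereal (q x ^ N / r x)) > 0" for N
  proof -
    obtain \<delta> where \<delta>: "0 < ereal \<delta>" "ereal \<delta> < Liminf at_top (\<lambda>x. ereal (q x ^ N / r x))"
      using ereal_dense2[OF L] by blast
    have "eventually (\<lambda>x. \<delta> * r x \<le> q x ^ N) at_top"
      using less_LiminfD[OF \<delta>(2)] eventually_ge_at_top[of a]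
      by eventually_elim (use r_pos in \<open>simp add: field_simps\<close>)
    then show False using power \<delta>(1) by simp
  qed
  ultimately show False
  proof cases
    case b
    then obtain C where C: "AE x in lebesgue. x \<in> {a..} \<longrightarrow> norm (s x) \<le> C"
      unfolding Linf_on_def by blast
    \<comment> \<open>The maximum with 1 ensures \<open>D > 0\<close>.\<close>
    define D where "D = sqrt (max C 1)"
    have "D > 0" by (simp add: D_def)
    \<comment> \<open>\<open>V\<close> is open by continuity of \<open>r\<close> and null by the
      essential bound, hence empty: \<open>r\<close> is at most \<open>D\<close> everywhere to the
      right of \<open>a\<close>. As \<open>q x ^ 0 = 1\<close>, this is a power bound with exponent
      0.\<close>
    define V where "V = {a<..} \<inter> r -` {D<..}"
    have "open V"
      unfolding V_def by (intro continuous_open_preimage cont_r) auto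
    moreover have "negligible V"
    proof -
      have "\<not> norm (s x) \<le> C" if "x \<in> V" for x
      proof
        assume "norm (s x) \<le> C"
        then have "r x \<le> D"
          unfolding r_def D_def by (simp add: powr_half_sqrt)
        then show False using that by (simp add: V_def)
      qed
      then have "AE x in lebesgue. x \<notin> V"
        using C by (auto simp: V_def elim!: eventually_mono)
      then show ?thesis
        using \<open>open V\<close> by (subst negligible_iff_null_sets) (auto simp: AE_iff_null_sets)
    qed
    ultimately have "V = {}" using open_not_negligible by blast
    then have "1 / D * r x \<le> q x ^ 0" if "a < x" for x
      using that \<open>D > 0\<close> by (auto simp: V_def)
    then have "eventually (\<lambda>x. 1 / D * r x \<le> q x ^ 0) at_top"
      using eventually_gt_at_top[of a] by (rule eventually_mono[rotated])
    then show False by (rule power[rotated]) (use \<open>D > 0\<close> in simp)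
  next
    case (e \<epsilon>)
    \<comment> \<open>The square root of \<open>s x\<close> has angle \<open>Arg (s x) / 2\<close>,
      at most \<open>(pi - \<epsilon>) / 2 < pi / 2\<close> in modulus, so \<open>\<delta>\<close>
      bounds \<open>q / r\<close> from below.\<close>
    define \<delta> where "\<delta> = cos ((pi - \<epsilon>) / 2)"
    \<comment> \<open>Evaluation at \<open>a\<close> gives \<open>\<epsilon> \<le> pi\<close>, which
      places the angle where the cosine is positive.\<close>
    have "0 \<le> pi - \<epsilon>" using e(2)[rule_format, of a] abs_ge_zero[of "Arg (s a)"] by linarith
    have "\<delta> > 0" unfolding \<delta>_def using e(1) \<open>0 \<le> pi - \<epsilon>\<close> by (intro cos_gt_zero_pi) auto
    moreover have "\<delta> * r x \<le> q x ^ 1" if "a \<le> x" for x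
    proof -
      have "cos ((pi - \<epsilon>) / 2) \<le> cos \<bar>Arg (s x) / 2\<bar>"
        using e(2)[rule_format, OF that] e(1) by (intro cos_monotone_0_pi_le) auto
      moreover have "q x = r x * cos (Arg (s x) / 2)"
        using Re_powr_of_real[of "s x" "1 / 2"] s0[OF that] by (simp add: q_def p_def r_def)
      ultimately show ?thesis
        unfolding cos_abs_real using r_pos[OF that] by (simp add: \<delta>_def)
    qed
    then have "eventually (\<lambda>x. \<delta> * r x \<le> q x ^ 1) at_top"
      using eventually_ge_at_top[of a] by (rule eventually_mono[rotated])
    ultimately show False by (rule power)
  qed (use liminf in blast)+
qed

end
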